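(* Let $\varsigma>0$ be a fixed absolute constant. There exists a continuous function $\widetilde c:(0,1)\to(0,1)$, $\xi\mapsto\widetilde c_\xi$, such that, for all integers $L\ge2$, all $\xi\in(-1,1)\setminus\{0\}$ and all $s\ge\varsigma$, $$\bigl|H_L\bigl(s(1+\xi)\bigr)-H_L(s)\bigr|\ge 2\,\widetilde c_{|\xi|}\,\min\{R_L(s),1\}.$$
   Context: $H_L(s)$ is the Shannon entropy (natural logarithm) at time $s$ of the rate-1 random walk on $\mathbb{Z}_L$ started at $0$, and $R_L(s):=\log L-H_L(s)$ is its relative entropy with respect to the uniform distribution on $\mathbb{Z}_L$. The walk is either the simple random walk (jumps at rate 1, each jump $+1$ or $-1$ mod $L$ with probability $1/2$ each) or the directed random walk (jumps at rate 1, each jump $+1$ mod $L$); the statement holds for both. *)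

theory Defs
  imports "HOL-Probability.Probability"
begin

datatype walk_kind = Simple | Directed

fun jump_pmf :: "walk_kind \<Rightarrow> int pmf" where
  "jump_pmf Simple = pmf_of_set {1, -1}"
| "jump_pmf Directed = return_pmf 1"

text \<open>The cyclic group of order \<open>L\<close> is the set of residues \<open>{0..<int L}\<close>, with addition
  modulo \<open>L\<close>. The position after \<open>n\<close> jumps of the walk started at 0:\<close>

primrec jump_chain :: "walk_kind \<Rightarrow> nat \<Rightarrow> nat \<Rightarrow> int pmf" where
  "jump_chain k L 0 = return_pmf 0"
| "jump_chain k L (Suc n) =
     bind_pmf (jump_chain k L n) (\<lambda>x. map_pmf (\<lambda>d. (x + d) mod int L) (jump_pmf k))"

text \<open>Jumping at rate 1 means that the number of jumps up to time \<open>s\<close> is Poisson with mean \<open>s\<close>,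
  independent of the jumps. The library's \<^const>\<open>poisson_pmf\<close> is specified for positive
  means only.\<close>

definition jump_count :: "real \<Rightarrow> nat pmf" where
  "jump_count s = (if 0 < s then poisson_pmf s else return_pmf 0)"

definition walk_law :: "walk_kind \<Rightarrow> nat \<Rightarrow> real \<Rightarrow> int pmf" where
  "walk_law k L s = bind_pmf (jump_count s) (jump_chain k L)"

text \<open>Shannon entropy of a discrete distribution in nats, as the library entropy to base \<open>exp 1\<close>
  with respect to counting measure; \<open>walk_entropy_eq\<close> below gives the explicit sum.\<close>

definition shannon_entropy :: "int pmf \<Rightarrow> real" where
  "shannon_entropy p = prob_space.entropy (measure_pmf p) (exp 1) (count_space UNIV) (\<lambda>x. x)"

definition walk_entropy :: "walk_kind \<Rightarrow> nat \<Rightarrow> real \<Rightarrow> real" where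
  "walk_entropy k L s = shannon_entropy (walk_law k L s)"

definition walk_rel_entropy :: "walk_kind \<Rightarrow> nat \<Rightarrow> real \<Rightarrow> real" where
  "walk_rel_entropy k L s = ln (real L) - walk_entropy k L s"

lemma shannon_entropy_eq_sum:
  assumes "finite A" "set_pmf p \<subseteq> A"
  shows "shannon_entropy p = - (\<Sum>x\<in>A. pmf p x * ln (pmf p x))"
proof -
  interpret information_space "measure_pmf p" "exp 1"
    by unfold_locales simp
  have sf: "sigma_finite_measure (count_space (UNIV :: int set))"
    by (rule sigma_finite_measure_count_space)
  have d: "distributed (measure_pmf p) (count_space UNIV) (\<lambda>x. x) (pmf p)"
    unfolding distributed_def
    by (simp add: measure_pmf_eq_density[symmetric] distr_id2 sets_measure_pmf)
  have "shannon_entropy p = - (\<integral>x. pmf p x * log (exp 1) (pmf p x) \<partial>count_space UNIV)"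
    unfolding shannon_entropy_def
    by (rule entropy_distr[OF d]) simp
  also have "(\<integral>x. pmf p x * log (exp 1) (pmf p x) \<partial>count_space UNIV)
      = (\<Sum>x\<in>A. pmf p x * log (exp 1) (pmf p x))"
    using assms
    by (subst lebesgue_integral_count_space_finite_support)
       (auto simp: set_pmf_iff intro!: sum.mono_neutral_left finite_subset[OF _ assms(1)])
  finally show ?thesis
    by (simp add: log_def)
qed

lemma set_jump_chain:
  assumes "L \<ge> 1"
  shows "set_pmf (jump_chain k L n) \<subseteq> {0..<int L}"
  using assms by (induction n) auto

lemma walk_entropy_eq:
  assumes "L \<ge> 1"
  shows "walk_entropy k L s
    = - (\<Sum>x\<in>{0..<int L}. pmf (walk_law k L s) x * ln (pmf (walk_law k L s) x))"
  unfolding walk_entropy_def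
  by (rule shannon_entropy_eq_sum) (use set_jump_chain[OF assms] in \<open>auto simp: walk_law_def\<close>)

end

theory Submission
  imports Defs
begin

text \<open>
  Write \<open>\<phi>\<^sub>s(m)\<close> for the Fourier coefficient of the law at time \<open>s\<close> at frequency \<open>m\<close>.
  The number of jumps is Poisson, so \<open>\<phi>\<^sub>s(m) = exp (s (u - 1))\<close>, where \<open>u\<close> is the Fourier
  coefficient of a single jump. For the simple and for the directed walk alike
  \<open>Re u = cos (2 \<pi> m / L)\<close>; hence both have \<open>|\<phi>\<^sub>s(m)|\<^sup>2 = exp (- 2 s \<lambda>\<^sub>m)\<close> with the frequency gap
  \<open>\<lambda>\<^sub>m = 1 - cos (2 \<pi> m / L)\<close>. The directed walk is not reversible, but only these
  moduli enter the proof, which is therefore the same for the two walks.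

  The law at time \<open>s + t\<close> is the convolution of the laws at times \<open>s\<close> and \<open>t\<close>, and the
  entropy gained is a mutual information: the average over \<open>y\<close>, drawn from the second
  law, of the relative entropy of the first law shifted by \<open>y\<close> with respect to the
  convolution. Relative entropy dominates the squared Hellinger distance, which by Cauchy-Schwarz
  dominates a quarter of the squared difference of any Fourier coefficient. A shift by \<open>y\<close>
  multiplies a Fourier coefficient by a character value, so the average is a variance,
  and for \<^emph>\<open>every\<close> frequency \<open>m\<close>
    \<open>H(s + t) - H(s) \<ge> |\<phi>\<^sub>s(m)|\<^sup>2 (1 - |\<phi>\<^sub>t(m)|\<^sup>2) / 4\<close>
  (lemmas \<open>entropy_gain_cyclic_conv\<close> and \<open>walk_entropy_increment\<close>).
  With \<open>t = s |\<xi>|\<close> the right-hand side depends only on \<open>s \<lambda>\<^sub>m\<close> and \<open>|\<xi>|\<close>, and it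
  remains to choose \<open>m\<close>. Let \<open>a\<close> be a small constant depending on \<open>\<sigma>\<close>.

  \<^item> Before relaxation, \<open>s \<lambda>\<^sub>1 < a\<close>. Doubling a frequency multiplies its gap, as long as the gap
  is at most 1, by a factor between 2 and 4. Some power of two \<open>m\<close> therefore has
  \<open>a \<le> s \<lambda>\<^sub>m \<le> 4 a\<close> (\<open>exists_resonant_frequency\<close>), and the gain is at least a constant.

  \<^item> After relaxation, \<open>s \<lambda>\<^sub>1 \<ge> a\<close>. The relative entropy is at most the chi-square distance to
  uniform, which by Parseval is the sum of \<open>exp (- 2 s \<lambda>\<^sub>m)\<close> over \<open>m \<noteq> 0\<close>. The gaps grow at
  least linearly in the distance of \<open>m\<close> to \<open>0\<close> modulo \<open>L\<close>, so the sum is at most a constant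
  times its term \<open>exp (- 2 s \<lambda>\<^sub>1)\<close> (\<open>sum_exp_freq_gap_le\<close>), and \<open>m = 1\<close> gives a gain of that
  order.
\<close>

section \<open>Fourier analysis on the cyclic group\<close>

definition character :: "nat \<Rightarrow> nat \<Rightarrow> int \<Rightarrow> complex" where
  "character L m x = cis (2 * pi * real m * real_of_int x / real L)"

definition fourier :: "nat \<Rightarrow> (int \<Rightarrow> real) \<Rightarrow> nat \<Rightarrow> complex" where
  "fourier L f m = (\<Sum>x\<in>{0..<int L}. of_real (f x) * character L m x)"

definition cyclic_conv :: "nat \<Rightarrow> (int \<Rightarrow> real) \<Rightarrow> (int \<Rightarrow> real) \<Rightarrow> int \<Rightarrow> real" where
  "cyclic_conv L f g x = (\<Sum>y\<in>{0..<int L}. g y * f ((x - y) mod int L))"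

lemma norm_character [simp]: "norm (character L m x) = 1"
  by (simp add: character_def)

lemma character_add: "character L m (x + y) = character L m x * character L m y"
  by (simp add: character_def cis_mult add_divide_distrib ring_distribs)

lemma character_mod:
  assumes "L > 0"
  shows "character L m (x mod int L) = character L m x"
proof -
  have "character L m (int L * (x div int L)) = cis (2 * pi * of_int (int m * (x div int L)))"
    using assms by (simp add: character_def mult.assoc)
  also have "\<dots> = 1"
    by (intro cis_multiple_2pi) auto
  finally have "character L m (x mod int L + int L * (x div int L)) = character L m (x mod int L)"
    by (subst character_add) simp
  thus ?thesis
    by simp
qed

lemma sum_cyclic_shift:
  fixes F :: "int \<Rightarrow> 'a :: comm_monoid_add"
  assumes "L > 0"
  shows "(\<Sum>x\<in>{0..<int L}. F ((x - y) mod int L)) = (\<Sum>x\<in>{0..<int L}. F x)"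
  by (rule sum.reindex_bij_witness[where i = "\<lambda>x. (x + y) mod int L" and
        j = "\<lambda>x. (x - y) mod int L"]) (use assms in \<open>auto simp: mod_simps\<close>)

lemma fourier_shift:
  assumes "L > 0"
  shows "fourier L (\<lambda>x. f ((x - y) mod int L)) m = character L m y * fourier L f m"
proof -
  have "fourier L (\<lambda>x. f ((x - y) mod int L)) m
      = (\<Sum>x\<in>{0..<int L}. character L m y *
          (of_real (f ((x - y) mod int L)) * character L m ((x - y) mod int L)))"
    unfolding fourier_def
  proof (rule sum.cong)
    fix x
    have "character L m x = character L m y * character L m ((x - y) mod int L)"
      using assms by (simp add: character_mod character_add[symmetric])
    thus "of_real (f ((x - y) mod int L)) * character L m x = character L m y *
          (of_real (f ((x - y) mod int L)) * character L m ((x - y) mod int L))"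
      by simp
  qed simp
  also have "\<dots> = character L m y * fourier L f m"
    unfolding fourier_def sum_distrib_left[symmetric]
    by (subst sum_cyclic_shift[OF assms, where F = "\<lambda>x. of_real (f x) * character L m x"]) simp
  finally show ?thesis .
qed

lemma fourier_cyclic_conv:
  assumes "L > 0"
  shows "fourier L (cyclic_conv L f g) m = fourier L f m * fourier L g m"
proof -
  have "fourier L (cyclic_conv L f g) m
      = (\<Sum>y\<in>{0..<int L}. of_real (g y) * fourier L (\<lambda>x. f ((x - y) mod int L)) m)"
    unfolding fourier_def cyclic_conv_def of_real_sum sum_distrib_right sum_distrib_left
    by (subst sum.swap) (simp add: mult_ac)
  also have "\<dots> = fourier L f m * fourier L g m"
    by (simp add: fourier_shift[OF assms] fourier_def[of L g] sum_distrib_left mult_ac)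
  finally show ?thesis .
qed

lemma fourier_diff: "fourier L (\<lambda>x. f x - g x) m = fourier L f m - fourier L g m"
  by (simp add: fourier_def sum_subtractf left_diff_distrib)

lemma fourier_0: "fourier L f 0 = of_real (\<Sum>x\<in>{0..<int L}. f x)"
  by (simp add: fourier_def character_def)

text \<open>For \<open>x \<noteq> y\<close> the sum is geometric with ratio an \<open>L\<close>-th root of unity different from 1.\<close>

lemma sum_character_orthogonal:
  assumes "x \<in> {0..<int L}" "y \<in> {0..<int L}"
  shows "(\<Sum>m<L. character L m x * cnj (character L m y)) = (if x = y then of_nat L else 0)"
proof (cases "x = y")
  case True
  thus ?thesis
    by (simp flip: complex_norm_square)
next
  case False
  define w where "w = cis (2 * pi * (real_of_int (x - y) / real L))"
  have L: "L > 0" using assms by auto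
  have "character L m x * cnj (character L m y) = w ^ m" for m
    unfolding w_def Complex.DeMoivre
    by (simp add: character_def cis_cnj cis_mult field_simps diff_divide_distrib)
  moreover have "w ^ L = 1"
  proof -
    have "real L * (2 * pi * (real_of_int (x - y) / real L)) = 2 * pi * real_of_int (x - y)"
      using L by simp
    thus ?thesis
      unfolding w_def Complex.DeMoivre by (simp only: cis_multiple_2pi Ints_of_int)
  qed
  moreover have "w \<noteq> 1"
  proof
    assume "w = 1"
    hence "cos (2 * pi * (real_of_int (x - y) / real L)) = 1"
      unfolding w_def by (metis cis.simps(1) one_complex.simps(1))
    then obtain n :: int where "2 * pi * (real_of_int (x - y) / real L) = of_int n * 2 * pi"
      unfolding cos_one_2pi_int by blast
    hence "2 * pi * (real_of_int (x - y) / real L) = 2 * pi * of_int n"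
      by (simp only: mult_ac)
    hence "real_of_int (x - y) / real L = of_int n"
      unfolding mult_cancel_left using pi_gt_zero by linarith
    hence "real_of_int (x - y) = of_int (n * int L)"
      using L by (simp add: divide_eq_eq)
    hence *: "x - y = n * int L"
      by linarith
    have "\<bar>x - y\<bar> < int L" using assms by auto
    hence "\<bar>n\<bar> * int L < 1 * int L"
      unfolding * by (simp add: abs_mult)
    hence "\<bar>n\<bar> < 1"
      using L by (subst (asm) mult_less_cancel_right) auto
    thus False using * False by simp
  qed
  ultimately show ?thesis
    using False by (simp add: geometric_sum)
qed

lemma parseval:
  "(\<Sum>m<L. (norm (fourier L f m))\<^sup>2) = real L * (\<Sum>x\<in>{0..<int L}. (f x)\<^sup>2)"
proof -
  have "complex_of_real (\<Sum>m<L. (norm (fourier L f m))\<^sup>2)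
     = (\<Sum>m<L. fourier L f m * cnj (fourier L f m))"
    by (simp only: of_real_sum complex_norm_square)
  also have "\<dots> = (\<Sum>m<L. \<Sum>x\<in>{0..<int L}. \<Sum>y\<in>{0..<int L}.
      of_real (f x * f y) * (character L m x * cnj (character L m y)))"
    by (simp add: fourier_def sum_product mult_ac)
  also have "\<dots> = (\<Sum>x\<in>{0..<int L}. \<Sum>y\<in>{0..<int L}. 
      of_real (f x * f y) * (\<Sum>m<L. character L m x * cnj (character L m y)))"
    by (subst sum.swap, intro sum.cong refl, subst sum.swap) (simp add: sum_distrib_left)
  also have "\<dots> = (\<Sum>x\<in>{0..<int L}. \<Sum>y\<in>{0..<int L}. 
      if x = y then of_real (f x * f y) * of_nat L else 0)"
    by (intro sum.cong refl) (subst sum_character_orthogonal, auto)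
  also have "\<dots> = complex_of_real (real L * (\<Sum>x\<in>{0..<int L}. (f x)\<^sup>2))"
    by (simp add: sum_distrib_left power2_eq_square mult_ac)
  finally show ?thesis
    using of_real_eq_iff by blast
qed

text \<open>Parseval applied to \<open>f - g\<close>. This is how laws are identified through their Fourier
  coefficients below.\<close>

lemma fourier_inject:
  assumes "\<And>m. m < L \<Longrightarrow> fourier L f m = fourier L g m" and x: "x \<in> {0..<int L}"
  shows "f x = g x"
proof -
  have "real L * (\<Sum>x\<in>{0..<int L}. (f x - g x)\<^sup>2) = 0"
    unfolding parseval[symmetric] using assms(1) by (simp add: fourier_diff)
  hence "(\<Sum>x\<in>{0..<int L}. (f x - g x)\<^sup>2) = 0"
    using x by auto
  hence "(f x - g x)\<^sup>2 = 0"
    using x by (subst (asm) sum_nonneg_eq_0_iff) auto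
  thus ?thesis by simp
qed

section \<open>Entropy gain under convolution\<close>

text \<open>Factor \<open>p - q = (\<surd>p - \<surd>q) (\<surd>p + \<surd>q)\<close> and apply Cauchy-Schwarz; the square sum of the
  second factor is at most \<open>2 \<Sum> (p + q) = 4\<close>.\<close>

lemma norm_fourier_diff_le_hellinger:
  assumes "\<And>x. p x \<ge> 0" "\<And>x. q x \<ge> 0"
  assumes "(\<Sum>x\<in>{0..<int L}. p x) = 1" "(\<Sum>x\<in>{0..<int L}. q x) = 1"
  shows "(norm (fourier L p m - fourier L q m))\<^sup>2
    \<le> 4 * (\<Sum>x\<in>{0..<int L}. (sqrt (p x) - sqrt (q x))\<^sup>2)"
proof -
  let ?a = "\<lambda>x. \<bar>sqrt (p x) - sqrt (q x)\<bar>" and ?b = "\<lambda>x. sqrt (p x) + sqrt (q x)"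
  have pq: "\<bar>p x - q x\<bar> = ?a x * ?b x" for x
  proof -
    have "p x - q x = (sqrt (p x) - sqrt (q x)) * (sqrt (p x) + sqrt (q x))"
      using assms(1,2)[of x] by (simp add: algebra_simps)
    thus ?thesis
      using assms(1,2)[of x] by (simp add: abs_mult)
  qed
  have "norm (fourier L p m - fourier L q m) \<le> (\<Sum>x\<in>{0..<int L}. \<bar>p x - q x\<bar>)"
    unfolding fourier_diff[symmetric] fourier_def[of L "\<lambda>x. p x - q x"]
    by (rule order.trans[OF norm_sum]) (simp add: norm_mult del: of_real_diff)
  also have "\<dots> = (\<Sum>x\<in>{0..<int L}. ?a x * ?b x)"
    by (simp add: pq)
  finally have "(norm (fourier L p m - fourier L q m))\<^sup>2 \<le> (\<Sum>x\<in>{0..<int L}. ?a x * ?b x)\<^sup>2"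
    by (intro power_mono) auto
  also have "\<dots> \<le> (\<Sum>x\<in>{0..<int L}. (?a x)\<^sup>2) * (\<Sum>x\<in>{0..<int L}. (?b x)\<^sup>2)"
    by (rule Cauchy_Schwarz_ineq_sum)
  also have "\<dots> \<le> (\<Sum>x\<in>{0..<int L}. (?a x)\<^sup>2) * 4"
  proof (rule mult_left_mono)
    have "(?b x)\<^sup>2 \<le> 2 * p x + 2 * q x" for x
    proof -
      have "(?b x)\<^sup>2 + (sqrt (p x) - sqrt (q x))\<^sup>2 = 2 * p x + 2 * q x"
        using assms(1,2)[of x] by (simp add: power2_sum power2_diff)
      thus ?thesis
        using zero_le_power2[of "sqrt (p x) - sqrt (q x)"] by linarith
    qed
    hence "(\<Sum>x\<in>{0..<int L}. (?b x)\<^sup>2) \<le> (\<Sum>x\<in>{0..<int L}. 2 * p x + 2 * q x)"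
      by (rule sum_mono)
    also have "\<dots> = 4"
      unfolding sum.distrib sum_distrib_left[symmetric] assms by simp
    finally show "(\<Sum>x\<in>{0..<int L}. (?b x)\<^sup>2) \<le> 4" .
  qed (auto intro: sum_nonneg)
  finally show ?thesis by simp
qed

text \<open>The right-hand side is the gap between \<open>u ln u\<close> and its tangent at \<open>q\<close>, evaluated at \<open>p\<close>;
  it equals \<open>p ln (p / q) - p + q\<close>, and \<open>ln r \<le> r - 1\<close> at \<open>r = \<surd>(q / p)\<close> bounds it.
  Keeping the linear term makes the bound hold pointwise, without normalization;
  the term disappears when \<open>p\<close> is averaged to \<open>q\<close>.\<close>

lemma bregman_hellinger:
  fixes p q :: real
  assumes "p \<ge> 0" "q > 0"
  shows "(sqrt p - sqrt q)\<^sup>2 \<le> p * ln p - q * ln q - (ln q + 1) * (p - q)"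
proof (cases "p = 0")
  case False
  hence p: "p > 0" using assms by simp
  have "ln (sqrt q / sqrt p) \<le> sqrt q / sqrt p - 1"
    using p assms by (intro ln_le_minus_one) auto
  hence "(ln q - ln p) / 2 \<le> sqrt q / sqrt p - 1"
    using p assms by (simp add: ln_div ln_sqrt diff_divide_distrib)
  hence "2 * p * ((ln q - ln p) / 2) \<le> 2 * p * (sqrt q / sqrt p - 1)"
    using p by (intro mult_left_mono) auto
  also have "\<dots> = 2 * (sqrt p * sqrt p) * (sqrt q / sqrt p) - 2 * p"
    using p by (simp add: algebra_simps)
  also have "\<dots> = 2 * (sqrt p * sqrt q) - 2 * p"
    using p by (simp add: field_simps)
  finally have "p * ln q - p * ln p \<le> 2 * (sqrt p * sqrt q) - 2 * p"
    by (simp add: right_diff_distrib)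
  thus ?thesis
    using p assms by (simp add: power2_diff algebra_simps)
qed (use assms in \<open>simp add: algebra_simps\<close>)

text \<open>Average the pointwise bound. If \<open>q = 0\<close> there is no tangent, but then every \<open>p y\<close> of
  positive weight vanishes and both sides are 0; so the laws need not have full support.\<close>

lemma jensen_gap_hellinger:
  fixes w p :: "'a \<Rightarrow> real"
  assumes fin: "finite A" and w: "\<And>y. w y \<ge> 0" "(\<Sum>y\<in>A. w y) = 1" and p: "\<And>y. p y \<ge> 0"
  defines "q \<equiv> (\<Sum>y\<in>A. w y * p y)"
  shows "(\<Sum>y\<in>A. w y * (sqrt (p y) - sqrt q)\<^sup>2) \<le> (\<Sum>y\<in>A. w y * (p y * ln (p y))) - q * ln q"
proof (cases "q = 0")
  case True
  hence "w y * p y = 0" if "y \<in> A" for y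
    using that w p fin unfolding q_def by (subst (asm) sum_nonneg_eq_0_iff) auto
  hence "w y = 0 \<or> p y = 0" if "y \<in> A" for y
    using that by auto
  hence "w y * (sqrt (p y) - sqrt q)\<^sup>2 = 0" "w y * (p y * ln (p y)) = 0" if "y \<in> A" for y
    using that True by fastforce+
  hence "(\<Sum>y\<in>A. w y * (sqrt (p y) - sqrt q)\<^sup>2) = 0" "(\<Sum>y\<in>A. w y * (p y * ln (p y))) = 0"
    by (auto intro: sum.neutral simp del: mult_eq_0_iff)
  thus ?thesis
    using True by simp
next
  case False
  hence q: "q > 0"
    using w p unfolding q_def by (simp add: order_less_le sum_nonneg)
  have "(\<Sum>y\<in>A. w y * (sqrt (p y) - sqrt q)\<^sup>2)
      \<le> (\<Sum>y\<in>A. w y * (p y * ln (p y) - q * ln q - (ln q + 1) * (p y - q)))"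
    using q p w by (intro sum_mono mult_left_mono bregman_hellinger) auto
  also have "\<dots> = (\<Sum>y\<in>A. w y * (p y * ln (p y))) - (\<Sum>y\<in>A. w y) * (q * ln q)
      - (ln q + 1) * ((\<Sum>y\<in>A. w y * p y) - (\<Sum>y\<in>A. w y) * q)"
    by (simp add: algebra_simps sum.distrib sum_subtractf sum_distrib_left sum_distrib_right)
  also have "\<dots> = (\<Sum>y\<in>A. w y * (p y * ln (p y))) - q * ln q"
    by (simp add: w q_def)
  finally show ?thesis .
qed

lemma sum_cyclic_conv:
  assumes "L > 0"
  shows "(\<Sum>x\<in>{0..<int L}. cyclic_conv L f g x)
    = (\<Sum>x\<in>{0..<int L}. f x) * (\<Sum>x\<in>{0..<int L}. g x)"
  using fourier_cyclic_conv[OF assms, of f g 0]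
  unfolding fourier_0 of_real_mult[symmetric] of_real_eq_iff .

text \<open>The mean of \<open>character L m\<close> under \<open>g\<close> is \<open>fourier L g m\<close>, and its values have modulus 1.\<close>

lemma character_variance:
  assumes "(\<Sum>x\<in>{0..<int L}. g x) = 1"
  shows "(\<Sum>y\<in>{0..<int L}. g y * (norm (character L m y - fourier L g m))\<^sup>2)
    = 1 - (norm (fourier L g m))\<^sup>2"
proof -
  let ?w = "fourier L g m"
  have "(norm (character L m y - ?w))\<^sup>2
      = 1 + (norm ?w)\<^sup>2 - 2 * Re (character L m y * cnj ?w)" for y
  proof -
    have "(norm (character L m y))\<^sup>2 = 1" by simp
    thus ?thesis
      unfolding cmod_power2 by (simp add: power2_diff algebra_simps)
  qed
  hence "(\<Sum>y\<in>{0..<int L}. g y * (norm (character L m y - ?w))\<^sup>2)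
      = (\<Sum>y\<in>{0..<int L}. g y * (1 + (norm ?w)\<^sup>2 - 2 * Re (character L m y * cnj ?w)))"
    by (simp only:)
  also have "\<dots> = (\<Sum>y\<in>{0..<int L}. g y) * (1 + (norm ?w)\<^sup>2)
        - 2 * (\<Sum>y\<in>{0..<int L}. g y * Re (character L m y * cnj ?w))"
    unfolding sum_distrib_left sum_distrib_right sum_subtractf[symmetric]
    by (intro sum.cong refl) (simp only: algebra_simps)
  also have "(\<Sum>y\<in>{0..<int L}. g y * Re (character L m y * cnj ?w))
      = Re ((\<Sum>y\<in>{0..<int L}. of_real (g y) * character L m y) * cnj ?w)"
    unfolding sum_distrib_right Re_sum by (intro sum.cong refl) (simp add: algebra_simps)
  also have "(\<Sum>y\<in>{0..<int L}. g y) * (1 + (norm ?w)\<^sup>2)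
        - 2 * Re ((\<Sum>y\<in>{0..<int L}. of_real (g y) * character L m y) * cnj ?w)
      = 1 + (norm ?w)\<^sup>2 - 2 * Re (?w * cnj ?w)"
    unfolding assms fourier_def[symmetric] by simp
  also have "Re (?w * cnj ?w) = (norm ?w)\<^sup>2"
    by (simp flip: complex_norm_square)
  finally show ?thesis by simp
qed

text \<open>The convolution is the \<open>g\<close>-average of the shifts of \<open>f\<close>, all of which have the entropy of \<open>f\<close>,
  so the entropy gain is a sum of Jensen gaps over the points of the group.\<close>

lemma entropy_gain_cyclic_conv:
  assumes L: "L > 0" and f: "\<And>x. f x \<ge> 0" "(\<Sum>x\<in>{0..<int L}. f x) = 1"
    and g: "\<And>x. g x \<ge> 0" "(\<Sum>x\<in>{0..<int L}. g x) = 1"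
  shows "(norm (fourier L f m))\<^sup>2 * (1 - (norm (fourier L g m))\<^sup>2) / 4
    \<le> (\<Sum>x\<in>{0..<int L}. f x * ln (f x))
      - (\<Sum>x\<in>{0..<int L}. cyclic_conv L f g x * ln (cyclic_conv L f g x))"
proof -
  define Z where "Z = {0..<int L}"
  define q where "q = cyclic_conv L f g"
  define p where "p = (\<lambda>y x. f ((x - y) mod int L))"
  have q_eq: "q x = (\<Sum>y\<in>Z. g y * p y x)" for x
    by (simp add: q_def p_def cyclic_conv_def Z_def)
  have p_sum: "(\<Sum>x\<in>Z. p y x) = 1" for y
    unfolding p_def Z_def sum_cyclic_shift[OF L, of f] by (rule f)
  have p_nn: "p y x \<ge> 0" for x y
    by (simp add: p_def f)
  have q_nn: "q x \<ge> 0" for x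
    unfolding q_eq using p_nn g by (intro sum_nonneg) auto
  have q_sum: "(\<Sum>x\<in>Z. q x) = 1"
    unfolding Z_def q_def sum_cyclic_conv[OF L] by (simp add: f g)
  have "(norm (fourier L f m))\<^sup>2 * (1 - (norm (fourier L g m))\<^sup>2) / 4
      = (\<Sum>y\<in>Z. g y * ((norm (fourier L f m))\<^sup>2 *
            (norm (character L m y - fourier L g m))\<^sup>2)) / 4"
    unfolding character_variance[OF g(2), symmetric] sum_distrib_left Z_def by (simp add: mult_ac)
  also have "\<dots> = (\<Sum>y\<in>Z. g y * ((norm (fourier L (p y) m - fourier L q m))\<^sup>2 / 4))"
  proof -
    have "(norm (fourier L f m))\<^sup>2 * (norm (character L m y - fourier L g m))\<^sup>2
        = (norm (fourier L (p y) m - fourier L q m))\<^sup>2" for y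
      unfolding p_def q_def fourier_shift[OF L] fourier_cyclic_conv[OF L]
        power_mult_distrib[symmetric] norm_mult[symmetric]
      by (simp add: algebra_simps)
    thus ?thesis by (simp add: sum_divide_distrib)
  qed
  also have "\<dots> \<le> (\<Sum>y\<in>Z. g y * (\<Sum>x\<in>Z. (sqrt (p y x) - sqrt (q x))\<^sup>2))"
  proof (intro sum_mono mult_left_mono g)
    fix y
    show "(norm (fourier L (p y) m - fourier L q m))\<^sup>2 / 4
        \<le> (\<Sum>x\<in>Z. (sqrt (p y x) - sqrt (q x))\<^sup>2)"
      using norm_fourier_diff_le_hellinger[of "p y" q L m] p_nn q_nn p_sum q_sum
      unfolding Z_def by simp
  qed
  also have "\<dots> = (\<Sum>x\<in>Z. \<Sum>y\<in>Z. g y * (sqrt (p y x) - sqrt (q x))\<^sup>2)"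
    unfolding sum_distrib_left by (rule sum.swap)
  also have "\<dots> \<le> (\<Sum>x\<in>Z. (\<Sum>y\<in>Z. g y * (p y x * ln (p y x))) - q x * ln (q x))"
    unfolding q_eq using g p_nn
    by (intro sum_mono jensen_gap_hellinger) (auto simp: Z_def)
  also have "\<dots> = (\<Sum>y\<in>Z. g y * (\<Sum>x\<in>Z. p y x * ln (p y x))) - (\<Sum>x\<in>Z. q x * ln (q x))"
    unfolding sum_subtractf sum_distrib_left
    by (subst sum.swap[of "\<lambda>x y. g y * (p y x * ln (p y x))"]) (rule refl)
  also have "(\<Sum>y\<in>Z. g y * (\<Sum>x\<in>Z. p y x * ln (p y x))) = (\<Sum>x\<in>Z. f x * ln (f x))"
  proof -
    have "(\<Sum>x\<in>Z. p y x * ln (p y x)) = (\<Sum>x\<in>Z. f x * ln (f x))" for y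
      unfolding p_def Z_def by (rule sum_cyclic_shift[OF L, of "\<lambda>x. f x * ln (f x)"])
    thus ?thesis
      using g by (simp add: Z_def flip: sum_distrib_right)
  qed
  finally show ?thesis by (simp add: Z_def q_def)
qed

text \<open>Relative entropy to uniform is at most the chi-square distance, by \<open>ln r \<le> r - 1\<close> at
  \<open>r = L f(x)\<close>; the chi-square distance is \<open>L \<Sum> f\<^sup>2 - 1\<close>, and in Parseval's identity the 1
  is the contribution of frequency 0.\<close>

lemma log_card_minus_entropy_le_chi_square:
  assumes f: "\<And>x. f x \<ge> 0" "(\<Sum>x\<in>{0..<int L}. f x) = 1"
  shows "ln (real L) + (\<Sum>x\<in>{0..<int L}. f x * ln (f x))
    \<le> (\<Sum>m\<in>{1..<L}. (norm (fourier L f m))\<^sup>2)"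
proof -
  have L: "L > 0" using f(2) by (cases "L = 0") auto
  have "ln (real L) + (\<Sum>x\<in>{0..<int L}. f x * ln (f x))
      = (\<Sum>x\<in>{0..<int L}. f x * ln (real L) + f x * ln (f x))"
    unfolding sum.distrib sum_distrib_right[symmetric] f by simp
  also have "\<dots> \<le> (\<Sum>x\<in>{0..<int L}. real L * (f x)\<^sup>2 - f x)"
  proof (rule sum_mono)
    fix x
    show "f x * ln (real L) + f x * ln (f x) \<le> real L * (f x)\<^sup>2 - f x"
    proof (cases "f x = 0")
      case False
      hence fx: "f x > 0" using f(1)[of x] by simp
      have "f x * ln (real L * f x) \<le> f x * (real L * f x - 1)"
        using fx L by (intro mult_left_mono ln_le_minus_one) auto
      thus ?thesis
        using fx L by (simp add: ln_mult algebra_simps power2_eq_square)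
    qed simp
  qed
  also have "\<dots> = (\<Sum>m<L. (norm (fourier L f m))\<^sup>2) - 1"
    unfolding parseval sum_subtractf f by (simp add: sum_distrib_left)
  also have "{..<L} = insert 0 {1..<L}" using L by auto
  also have "(\<Sum>m\<in>\<dots>. (norm (fourier L f m))\<^sup>2) - 1 = (\<Sum>m\<in>{1..<L}. (norm (fourier L f m))\<^sup>2)"
    by (simp add: fourier_0 f)
  finally show ?thesis .
qed

section \<open>Fourier coefficients and entropy of the walk\<close>

definition freq_gap :: "nat \<Rightarrow> nat \<Rightarrow> real" where
  "freq_gap L m = 1 - cos (2 * pi * real m / real L)"

definition jump_symbol :: "walk_kind \<Rightarrow> nat \<Rightarrow> nat \<Rightarrow> complex" where
  "jump_symbol k L m = measure_pmf.expectation (jump_pmf k) (character L m)"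

lemma finite_set_jump_pmf [simp]: "finite (set_pmf (jump_pmf k))"
  by (cases k) auto

text \<open>Passing from the directed to the simple walk averages \<open>cis \<theta>\<close> with its conjugate, which
  keeps the real part.\<close>

lemma Re_jump_symbol: "Re (jump_symbol k L m) = 1 - freq_gap L m"
proof (cases k)
  case Simple
  have "jump_symbol k L m = (\<Sum>d\<in>{1,-1}. pmf (jump_pmf k) d *\<^sub>R character L m d)"
    unfolding jump_symbol_def Simple by (intro integral_measure_pmf) auto
  thus ?thesis
    by (simp add: Simple character_def freq_gap_def)
qed (simp add: jump_symbol_def character_def freq_gap_def)

lemma fourier_pmf:
  assumes "set_pmf p \<subseteq> {0..<int L}"
  shows "fourier L (pmf p) m = measure_pmf.expectation p (character L m)"
  unfolding fourier_def using assms
  by (subst integral_measure_pmf[of "{0..<int L}"]) (auto simp: scaleR_conv_of_real)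

lemma fourier_jump_chain:
  assumes L: "L > 0"
  shows "fourier L (pmf (jump_chain k L n)) m = jump_symbol k L m ^ n"
proof (induction n)
  case 0
  show ?case
    using L by (subst fourier_pmf) (auto simp: character_def)
next
  case (Suc n)
  have sub: "set_pmf (jump_chain k L i) \<subseteq> {0..<int L}" for i
    using L by (intro set_jump_chain) auto
  have "fourier L (pmf (jump_chain k L (Suc n))) m
      = (\<Sum>a\<in>{0..<int L}. pmf (jump_chain k L n) a *\<^sub>R
          measure_pmf.expectation (map_pmf (\<lambda>d. (a + d) mod int L) (jump_pmf k)) (character L m))"
    unfolding fourier_pmf[OF sub]
    unfolding jump_chain.simps by (intro pmf_expectation_bind sub) auto
  also have "\<dots> = (\<Sum>a\<in>{0..<int L}. pmf (jump_chain k L n) a *\<^sub>R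
          (character L m a * jump_symbol k L m))"
    using L by (simp add: character_mod character_add jump_symbol_def)
  also have "\<dots> = fourier L (pmf (jump_chain k L n)) m * jump_symbol k L m"
    by (simp add: fourier_def sum_distrib_left scaleR_conv_of_real mult_ac)
  finally show ?case
    by (simp add: Suc.IH mult.commute)
qed

lemma walk_law_sums:
  assumes s: "s > 0"
  shows "(\<lambda>n. s ^ n / fact n * exp (-s) * pmf (jump_chain k L n) x) sums pmf (walk_law k L s) x"
proof -
  let ?P = "poisson_pmf s" and ?f = "\<lambda>n. pmf (jump_chain k L n) x"
  have eq: "pmf (walk_law k L s) x = (\<integral>n. ?f n \<partial>measure_pmf ?P)"
    using s by (simp add: walk_law_def jump_count_def pmf_bind)
  have int: "integrable (measure_pmf ?P) ?f"
    by (rule measure_pmf.integrable_const_bound[where B = 1]) (auto simp: pmf_le_1)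
  have "integrable (count_space UNIV) (\<lambda>n. pmf ?P n * ?f n)"
    using int unfolding measure_pmf_eq_density by (subst (asm) integrable_density) auto
  hence "(\<lambda>n. pmf ?P n * ?f n) sums (\<integral>n. pmf ?P n * ?f n \<partial>count_space UNIV)"
    by (rule sums_integral_count_space_nat)
  also have "(\<integral>n. pmf ?P n * ?f n \<partial>count_space UNIV) = pmf (walk_law k L s) x"
    unfolding eq measure_pmf_eq_density by (subst integral_density) auto
  finally show ?thesis using s by simp
qed

text \<open>Averaging the powers of the jump symbol \<open>u\<close> over the Poisson number of jumps gives the
  series \<open>exp (- s) \<Sum> (s u)\<^sup>n / n!\<close>.\<close>

lemma fourier_walk_law:
  assumes L: "L > 0" and s: "s > 0"
  shows "fourier L (pmf (walk_law k L s)) m = exp (of_real s * (jump_symbol k L m - 1))"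
proof -
  let ?u = "jump_symbol k L m"
  have "(\<lambda>n. \<Sum>x\<in>{0..<int L}. of_real (s ^ n / fact n * exp (-s) * pmf (jump_chain k L n) x)
          * character L m x) sums fourier L (pmf (walk_law k L s)) m"
    unfolding fourier_def by (intro sums_sum sums_mult2 sums_of_real walk_law_sums s)
  also have "(\<lambda>n. \<Sum>x\<in>{0..<int L}. of_real (s ^ n / fact n * exp (-s) * pmf (jump_chain k L n) x)
          * character L m x) = (\<lambda>n. of_real (exp (-s)) * ((of_real s * ?u) ^ n /\<^sub>R fact n))"
  proof
    fix n
    have "(\<Sum>x\<in>{0..<int L}. of_real (s ^ n / fact n * exp (-s) * pmf (jump_chain k L n) x)
          * character L m x) = of_real (s ^ n / fact n * exp (-s)) * 
            fourier L (pmf (jump_chain k L n)) m"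
      by (simp add: fourier_def sum_distrib_left mult_ac)
    also have "\<dots> = of_real (exp (-s)) * ((of_real s * ?u) ^ n /\<^sub>R fact n)"
      unfolding fourier_jump_chain[OF L]
      by (simp add: power_mult_distrib scaleR_conv_of_real field_simps)
    finally show "(\<Sum>x\<in>{0..<int L}. of_real (s ^ n / fact n * exp (-s) * pmf (jump_chain k L n) x)
          * character L m x) = of_real (exp (-s)) * ((of_real s * ?u) ^ n /\<^sub>R fact n)" .
  qed
  finally have "(\<lambda>n. of_real (exp (-s)) * ((of_real s * ?u) ^ n /\<^sub>R fact n))
      sums fourier L (pmf (walk_law k L s)) m" .
  moreover have "(\<lambda>n. of_real (exp (-s)) * ((of_real s * ?u) ^ n /\<^sub>R fact n))
      sums (of_real (exp (-s)) * exp (of_real s * ?u))"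
    by (intro sums_mult exp_converges)
  ultimately have "fourier L (pmf (walk_law k L s)) m = of_real (exp (-s)) * exp (of_real s * ?u)"
    by (rule sums_unique2)
  also have "\<dots> = exp (of_real s * (?u - 1))"
    by (simp add: exp_of_real[symmetric] exp_add[symmetric] algebra_simps)
  finally show ?thesis .
qed

lemma norm_fourier_walk_law_sq:
  assumes "L > 0" "s > 0"
  shows "(norm (fourier L (pmf (walk_law k L s)) m))\<^sup>2 = exp (- 2 * s * freq_gap L m)"
  unfolding fourier_walk_law[OF assms] norm_exp_eq_Re
  by (simp add: Re_jump_symbol power2_eq_square flip: exp_add)

lemma sum_walk_law:
  assumes "L > 0"
  shows "(\<Sum>x\<in>{0..<int L}. pmf (walk_law k L s) x) = 1"
proof (rule sum_pmf_eq_1)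
  show "set_pmf (walk_law k L s) \<subseteq> {0..<int L}"
    using set_jump_chain[of L k] assms by (auto simp: walk_law_def)
qed simp

text \<open>The semigroup property is read off from the Fourier coefficients, which are exponentials
  in the time parameter.\<close>

lemma walk_law_add:
  assumes L: "L > 0" and s: "s > 0" and t: "t > 0" and x: "x \<in> {0..<int L}"
  shows "pmf (walk_law k L (s + t)) x
    = cyclic_conv L (pmf (walk_law k L s)) (pmf (walk_law k L t)) x"
proof (rule fourier_inject[OF _ x])
  fix m
  show "fourier L (pmf (walk_law k L (s + t))) m
      = fourier L (cyclic_conv L (pmf (walk_law k L s)) (pmf (walk_law k L t))) m"
    using L s t unfolding fourier_cyclic_conv[OF L]
    by (simp add: fourier_walk_law exp_add[symmetric] algebra_simps)
qed

lemma walk_entropy_increment: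
  assumes L: "L > 0" and s: "s > 0" and t: "t > 0"
  shows "exp (- 2 * s * freq_gap L m) * (1 - exp (- 2 * t * freq_gap L m)) / 4
    \<le> walk_entropy k L (s + t) - walk_entropy k L s"
proof -
  let ?f = "pmf (walk_law k L s)" and ?g = "pmf (walk_law k L t)"
  have "exp (- 2 * s * freq_gap L m) * (1 - exp (- 2 * t * freq_gap L m)) / 4
      \<le> (\<Sum>x\<in>{0..<int L}. ?f x * ln (?f x))
        - (\<Sum>x\<in>{0..<int L}. cyclic_conv L ?f ?g x * ln (cyclic_conv L ?f ?g x))"
    using entropy_gain_cyclic_conv[OF L pmf_nonneg sum_walk_law[OF L] pmf_nonneg sum_walk_law[OF L],
        of k s m k t]
    unfolding norm_fourier_walk_law_sq[OF L s] norm_fourier_walk_law_sq[OF L t] .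
  also have "\<dots> = walk_entropy k L (s + t) - walk_entropy k L s"
  proof -
    have "(\<Sum>x\<in>{0..<int L}. cyclic_conv L ?f ?g x * ln (cyclic_conv L ?f ?g x))
        = (\<Sum>x\<in>{0..<int L}. pmf (walk_law k L (s + t)) x * ln (pmf (walk_law k L (s + t)) x))"
      by (intro sum.cong refl) (simp only: walk_law_add[OF L s t])
    thus ?thesis
      using L by (simp add: walk_entropy_eq)
  qed
  finally show ?thesis .
qed

lemma freq_gap_nonneg: "freq_gap L m \<ge> 0"
  by (simp add: freq_gap_def)

text \<open>For negative \<open>\<xi>\<close> the increment runs from the earlier time \<open>s (1 + \<xi>)\<close> to \<open>s\<close>. The
  Fourier coefficients at the earlier time are no smaller in modulus, so the bound for positive \<open>\<xi>\<close> still holds.\<close>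

lemma walk_entropy_change:
  assumes L: "L > 0" and s: "s > 0" and \<xi>: "\<xi> \<in> {-1<..<1} - {0}"
  shows "exp (- 2 * s * freq_gap L m) * (1 - exp (- 2 * (s * \<bar>\<xi>\<bar>) * freq_gap L m)) / 4
    \<le> \<bar>walk_entropy k L (s * (1 + \<xi>)) - walk_entropy k L s\<bar>"
proof (cases "\<xi> > 0")
  case True
  have eq: "s * (1 + \<xi>) = s + s * \<xi>" "\<bar>\<xi>\<bar> = \<xi>" using True by (simp_all add: algebra_simps)
  show ?thesis
    unfolding eq using walk_entropy_increment[OF L s, of "s * \<xi>" m k] True s
    by (intro order.trans[OF _ abs_ge_self]) simp
next
  case False
  hence neg: "\<xi> < 0" and gt: "1 + \<xi> > 0" using \<xi> by auto
  have "exp (- 2 * s * freq_gap L m) \<le> exp (- 2 * (s * (1 + \<xi>)) * freq_gap L m)"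
  proof -
    have "s * (1 + \<xi>) * freq_gap L m \<le> s * 1 * freq_gap L m"
      using s neg freq_gap_nonneg[of L m] by (intro mult_right_mono mult_left_mono) auto
    thus ?thesis by simp
  qed
  moreover have "exp (- 2 * (s * \<bar>\<xi>\<bar>) * freq_gap L m) \<le> 1"
    using s freq_gap_nonneg[of L m] by simp
  ultimately have "exp (- 2 * s * freq_gap L m) * (1 - exp (- 2 * (s * \<bar>\<xi>\<bar>) * freq_gap L m)) / 4
      \<le> exp (- 2 * (s * (1 + \<xi>)) * freq_gap L m) * (1 - exp (- 2 * (s * \<bar>\<xi>\<bar>) * freq_gap L m)) / 4"
    by (intro divide_right_mono mult_right_mono) auto
  also have "\<dots> \<le> walk_entropy k L (s * (1 + \<xi>) + s * \<bar>\<xi>\<bar>) - walk_entropy k L (s * (1 + \<xi>))"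
    using s gt neg by (intro walk_entropy_increment L mult_pos_pos) auto
  also have "s * (1 + \<xi>) + s * \<bar>\<xi>\<bar> = s"
    using neg by (simp add: algebra_simps)
  finally show ?thesis
    unfolding abs_minus_commute[of "walk_entropy k L (s * (1 + \<xi>))"]
    by (rule order.trans[OF _ abs_ge_self])
qed

lemma walk_rel_entropy_le:
  assumes "L > 0" "s > 0"
  shows "walk_rel_entropy k L s \<le> (\<Sum>m\<in>{1..<L}. exp (- 2 * s * freq_gap L m))"
  using log_card_minus_entropy_le_chi_square[OF pmf_nonneg sum_walk_law[OF assms(1)], of k s] assms
  by (simp add: norm_fourier_walk_law_sq walk_rel_entropy_def walk_entropy_eq)

section \<open>Size of the frequency gaps\<close>

lemma freq_gap_double: "freq_gap L (2 * m) = 2 * freq_gap L m * (2 - freq_gap L m)"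
proof -
  have "cos (2 * pi * real (2 * m) / real L) = 2 * (cos (2 * pi * real m / real L))\<^sup>2 - 1"
    using cos_double_cos[of "2 * pi * real m / real L"] by (simp add: mult_ac)
  thus ?thesis
    by (simp add: freq_gap_def power2_eq_square algebra_simps)
qed

lemma freq_gap_eq_sin: "freq_gap L m = 2 * (sin (pi * real m / real L))\<^sup>2"
  using cos_double_sin[of "pi * real m / real L"] by (simp add: freq_gap_def mult_ac)

text \<open>A weak form of Jordan's inequality \<open>2 x / \<pi> \<le> sin x\<close>, from concavity of the sine.\<close>

lemma sin_ge_half:
  assumes "0 \<le> x" "x \<le> pi / 2"
  shows "x / 2 \<le> sin x"
proof -
  have "concave_on {0..pi} sin"
    by (rule f''_le0_imp_concave[where f' = cos and f'' = "\<lambda>x. - sin x"])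
       (auto intro!: derivative_eq_intros sin_ge_zero)
  hence "(1 - 2 * x / pi) * sin 0 + (2 * x / pi) * sin (pi / 2)
      \<le> sin ((1 - 2 * x / pi) *\<^sub>R 0 + (2 * x / pi) *\<^sub>R (pi / 2))"
    using assms by (intro concave_onD) (auto simp: field_simps)
  hence "2 * x / pi \<le> sin x"
    by simp
  moreover have "x / 2 \<le> 2 * x / pi"
    using assms pi_less_4 mult_right_mono[of pi 4 x] by (simp add: field_simps)
  ultimately show ?thesis by linarith
qed

text \<open>The gap is \<open>2 sin\<^sup>2 (m x)\<close> with \<open>x = \<pi> / L\<close>, and \<open>m x \<le> \<pi> / 2\<close>, where the sine
  increases and is at least half its argument. The growth is in fact quadratic in \<open>m\<close>; linear growth
  is enough to sum the exponentials as a geometric series.\<close>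

lemma freq_gap_growth:
  assumes m: "m \<ge> 1" "2 * m \<le> L"
  shows "freq_gap L 1 \<le> freq_gap L m" "real m / 4 * freq_gap L 1 \<le> freq_gap L m"
proof -
  define x where "x = pi / real L"
  have L: "real L > 0" using m by simp
  have "2 * real m \<le> real L"
    using m by linarith
  hence mx: "real m * x \<le> pi / 2"
    using L by (simp add: x_def field_simps)
  have x0: "x > 0" using L by (simp add: x_def)
  have x_le: "x \<le> real m * x"
    using m x0 by simp
  have gm: "freq_gap L n = 2 * (sin (real n * x))\<^sup>2" for n
    by (simp add: freq_gap_eq_sin x_def mult.commute)
  have sx0: "sin x \<ge> 0"
    using x0 mx x_le pi_gt_zero by (intro sin_ge_zero) linarith+
  have "sin x \<le> sin (real m * x)"
    using x0 mx x_le by (intro sin_monotone_2pi_le) linarith+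
  thus "freq_gap L 1 \<le> freq_gap L m"
    using sx0 by (simp add: gm power_mono)
  have "sin x \<le> x" using x0 by (intro sin_x_le_x) auto
  hence "real m * sin x / 2 \<le> real m * x / 2"
    by (intro divide_right_mono mult_left_mono) auto
  also have "\<dots> \<le> sin (real m * x)"
    using x0 mx by (intro sin_ge_half) auto
  finally have "(real m * sin x / 2)\<^sup>2 \<le> (sin (real m * x))\<^sup>2"
    using sx0 by (intro power_mono) auto
  moreover have "real m * 1 * (sin x)\<^sup>2 \<le> real m * real m * (sin x)\<^sup>2"
    using m by (intro mult_right_mono mult_left_mono) auto
  ultimately show "real m / 4 * freq_gap L 1 \<le> freq_gap L m"
    by (simp add: gm power2_eq_square mult_ac)
qed

lemma freq_gap_reflect:
  assumes "m \<le> L" "L > 0"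
  shows "freq_gap L (L - m) = freq_gap L m"
proof -
  have "2 * pi * real (L - m) / real L = 2 * pi - 2 * pi * real m / real L"
    using assms by (simp add: of_nat_diff field_simps)
  thus ?thesis
    by (simp add: freq_gap_def)
qed

lemma freq_gap_1_pos:
  assumes "L \<ge> 2"
  shows "freq_gap L 1 > 0"
proof -
  have "sin (pi / real L) > 0"
    using assms by (intro sin_gt_zero) (auto simp: field_simps)
  thus ?thesis by (simp add: freq_gap_eq_sin)
qed

text \<open>Relative to the term \<open>m = 1\<close>, the term \<open>m \<le> L / 2\<close> is at most \<open>exp (2 a) q\<^sup>m\<close> with
  \<open>q = exp (- a / 2)\<close>, because the gap ratio is at least 1 and at least \<open>m / 4\<close>. The terms with
  \<open>m > L / 2\<close> are mirror images of these.\<close>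

lemma sum_exp_freq_gap_le:
  assumes L: "L \<ge> 2" and a: "a > 0" "a \<le> s * freq_gap L 1"
  shows "(\<Sum>m\<in>{1..<L}. exp (- 2 * s * freq_gap L m))
    \<le> 2 * exp (2 * a) / (1 - exp (- a / 2)) * exp (- 2 * s * freq_gap L 1)"
proof -
  define q where "q = exp (- a / 2)"
  define E where "E = exp (- 2 * s * freq_gap L 1)"
  have q: "0 < q" "q < 1" using a by (auto simp: q_def)
  have half: "exp (- 2 * s * freq_gap L m) \<le> E * exp (2 * a) * q ^ m"
    if m: "m \<ge> 1" "2 * m \<le> L" for m
  proof -
    note gr = freq_gap_growth[OF m]
    define r where "r = freq_gap L m / freq_gap L 1"
    have r: "freq_gap L m = r * freq_gap L 1"
      using freq_gap_1_pos[OF L] by (simp add: r_def)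
    have r1: "r \<ge> 1" "r \<ge> real m / 4"
      using gr freq_gap_1_pos[OF L] unfolding r by auto
    (* s * freq_gap L 1 may be replaced by a only because r - 1 is nonnegative. *)
    have "a * (real m / 4 - 1) \<le> a * (r - 1)"
      using a r1 by (intro mult_left_mono) auto
    also have "\<dots> \<le> s * freq_gap L 1 * (r - 1)"
      using a r1 by (intro mult_right_mono) auto
    finally have "- 2 * s * freq_gap L m \<le> - 2 * s * freq_gap L 1 + 2 * a + real m * (- a / 2)"
      unfolding r by (simp add: algebra_simps)
    hence "exp (- 2 * s * freq_gap L m)
        \<le> exp (- 2 * s * freq_gap L 1 + 2 * a + real m * (- a / 2))"
      by simp
    also have "\<dots> = E * exp (2 * a) * q ^ m"
      unfolding E_def q_def exp_of_nat_mult[symmetric] exp_add ..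
    finally show ?thesis .
  qed
  have bound: "exp (- 2 * s * freq_gap L m) \<le> E * exp (2 * a) * (q ^ m + q ^ (L - m))"
    if m: "m \<in> {1..<L}" for m
  proof (cases "2 * m \<le> L")
    case True
    have "E * exp (2 * a) * q ^ m \<le> E * exp (2 * a) * (q ^ m + q ^ (L - m))"
      using q by (intro mult_left_mono) (auto simp: E_def)
    thus ?thesis using half[of m] True m by simp
  next
    case False
    have "E * exp (2 * a) * q ^ (L - m) \<le> E * exp (2 * a) * (q ^ m + q ^ (L - m))"
      using q by (intro mult_left_mono) (auto simp: E_def)
    thus ?thesis using half[of "L - m"] False m freq_gap_reflect[of m L] by force
  qed
  have refl: "(\<Sum>m\<in>{1..<L}. q ^ (L - m)) = (\<Sum>m\<in>{1..<L}. q ^ m)"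
    by (rule sum.reindex_bij_witness[where i = "\<lambda>m. L - m" and j = "\<lambda>m. L - m"]) auto
  have "(\<Sum>m\<in>{1..<L}. q ^ m) \<le> (\<Sum>m<L. q ^ m)"
    using q by (intro sum_mono2) auto
  also have "\<dots> = (1 - q ^ L) / (1 - q)"
    using q by (simp add: sum_gp_strict)
  also have "\<dots> \<le> 1 / (1 - q)"
    using q by (intro divide_right_mono) auto
  finally have geo: "(\<Sum>m\<in>{1..<L}. q ^ m) \<le> 1 / (1 - q)" .
  have "(\<Sum>m\<in>{1..<L}. exp (- 2 * s * freq_gap L m))
      \<le> (\<Sum>m\<in>{1..<L}. E * exp (2 * a) * (q ^ m + q ^ (L - m)))"
    by (rule sum_mono) (rule bound)
  also have "\<dots> = 2 * E * exp (2 * a) * (\<Sum>m\<in>{1..<L}. q ^ m)"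
    unfolding sum_distrib_left[symmetric] sum.distrib refl by simp
  also have "\<dots> \<le> 2 * E * exp (2 * a) * (1 / (1 - q))"
    by (intro mult_left_mono geo) (auto simp: E_def)
  finally show ?thesis by (simp add: E_def q_def mult_ac)
qed

text \<open>Double the frequency, starting from 1, until \<open>s\<close> times the gap reaches \<open>a\<close> for the first time.
  Since \<open>a < s\<close>, below this threshold the gap is less than 1; hence each doubling at least doubles
  it, so that the threshold is reached, and at most quadruples it, so that it is overshot by at
  most a factor 4.\<close>

lemma exists_resonant_frequency:
  assumes L: "L \<ge> 2" and a: "a > 0" "4 * a \<le> s" and small: "s * freq_gap L 1 < a"
  shows "\<exists>m. a \<le> s * freq_gap L m \<and> s * freq_gap L m \<le> 4 * a"
proof -
  define h where "h j = s * freq_gap L (2 ^ j)" for j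
  have s: "s > 0" using a by simp
  have h_step: "2 * h j \<le> h (Suc j)" "h (Suc j) \<le> 4 * h j" if "h j < a" for j
  proof -
    let ?g = "freq_gap L (2 ^ j)"
    have "s * ?g \<le> s * 1" using that a unfolding h_def by linarith
    hence g: "0 \<le> ?g" "?g \<le> 1"
      using s freq_gap_nonneg by (auto simp only: mult_le_cancel_left_pos)
    have "h (Suc j) = 2 * (2 - ?g) * (s * ?g)"
      unfolding h_def power_Suc freq_gap_double by (simp only: mult_ac)
    moreover have "2 * (s * ?g) \<le> 2 * (2 - ?g) * (s * ?g)" "2 * (2 - ?g) * (s * ?g) \<le> 4 * (s * ?g)"
      using g s by (intro mult_right_mono; simp)+
    ultimately show "2 * h j \<le> h (Suc j)" "h (Suc j) \<le> 4 * h j"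
      by (simp_all only: h_def)
  qed
  have h0: "h 0 > 0" using freq_gap_1_pos[OF L] s by (simp add: h_def)
  have "\<exists>j. a \<le> h j"
  proof (rule ccontr)
    assume "\<nexists>j. a \<le> h j"
    hence lt: "h j < a" for j by (simp add: not_le)
    have grow: "2 ^ j * h 0 \<le> h j" for j
    proof (induction j)
      case (Suc j)
      thus ?case using h_step(1)[OF lt, of j] by simp
    qed simp
    obtain j where "a / h 0 < 2 ^ j"
      using real_arch_pow[of 2] by auto
    hence "a < 2 ^ j * h 0" using h0 by (simp add: field_simps)
    thus False using grow[of j] lt[of j] by simp
  qed
  then obtain j where j: "a \<le> h j" "\<And>i. i < j \<Longrightarrow> h i < a"
    using exists_least_iff[of "\<lambda>j. a \<le> h j"] by (auto simp: not_le)
  have "j \<noteq> 0" using j(1) small by (auto simp: h_def intro!: gr0I)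
  then obtain i where i: "j = Suc i" by (cases j) auto
  have "h j \<le> 4 * a"
    using h_step(2)[of i] j(2)[of i] i by simp
  thus ?thesis using j(1) by (auto simp: h_def)
qed

section \<open>Entropy change under a relative change of time\<close>

theorem lemmaB20:
  fixes k :: walk_kind and \<sigma> :: real
  assumes "\<sigma> > 0"
  shows "\<exists>c :: real \<Rightarrow> real. continuous_on {0<..<1} c \<and> c \<in> {0<..<1} \<rightarrow> {0<..<1} \<and>
    (\<forall>L::nat. \<forall>\<xi>::real. \<forall>s::real.
       L \<ge> 2 \<longrightarrow> \<xi> \<in> {-1<..<1} - {0} \<longrightarrow> s \<ge> \<sigma> \<longrightarrow>
       \<bar>walk_entropy k L (s * (1 + \<xi>)) - walk_entropy k L s\<bar>
         \<ge> 2 * c \<bar>\<xi>\<bar> * min (walk_rel_entropy k L s) 1)"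
proof -
  (* 4 a <= sigma is what the choice of a resonant frequency requires of every s >= sigma;
     4 a <= 1 keeps exp (- 2 s * gap) at least exp (-2) at that frequency. *)
  define a where "a = min \<sigma> 1 / 4"
  define C where "C = 2 * exp (2 * a) / (1 - exp (- a / 2))"
  (* Let N be the numerator of c and E = exp (- 2 s * freq_gap L 1). Twice c has to stay below
     exp (-2) * N / 4 before relaxation, and twice c times C * E below E * N / 4 after it;
     the two summands of K serve these two bounds. *)
  define K where "K = 8 * (exp 2 + C)"
  define c where "c \<eta> = (1 - exp (- 2 * a * \<eta>)) / K" for \<eta> :: real
  have a: "a > 0" "4 * a \<le> 1" "4 * a \<le> \<sigma>"
    using assms by (auto simp: a_def min_def)
  have C: "C > 0" using a by (simp add: C_def)
  have "exp (2 :: real) > 1" by simp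
  hence K: "K > 1" "K \<ge> 8 * exp 2" "K \<ge> 8 * C"
    using C unfolding K_def by (auto simp del: one_less_exp_iff)
  have "continuous_on {0<..<1} c"
    unfolding c_def using K by (intro continuous_intros) auto
  moreover have "c \<in> {0<..<1} \<rightarrow> {0<..<1}"
  proof
    fix \<eta> :: real assume \<eta>: "\<eta> \<in> {0<..<1}"
    hence "0 < exp (- 2 * a * \<eta>)" "exp (- 2 * a * \<eta>) < 1" using a by auto
    thus "c \<eta> \<in> {0<..<1}" using K(1) by (simp add: c_def del: exp_gt_zero exp_less_one_iff)
  qed
  moreover have "2 * c \<bar>\<xi>\<bar> * min (walk_rel_entropy k L s) 1
      \<le> \<bar>walk_entropy k L (s * (1 + \<xi>)) - walk_entropy k L s\<bar>"
    if L: "L \<ge> 2" and \<xi>: "\<xi> \<in> {-1<..<1} - {0}" and s: "s \<ge> \<sigma>" for L \<xi> s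
  proof -
    define D where "D = \<bar>walk_entropy k L (s * (1 + \<xi>)) - walk_entropy k L s\<bar>"
    define N where "N = 1 - exp (- 2 * a * \<bar>\<xi>\<bar>)"
    have N: "N > 0" using a \<xi> by (simp add: N_def)
    have s0: "s > 0" and L0: "L > 0" using s assms L by auto
    have D: "exp (- 2 * (s * freq_gap L m)) * N / 4 \<le> D" if "a \<le> s * freq_gap L m" for m
    proof -
      have "a * \<bar>\<xi>\<bar> \<le> s * freq_gap L m * \<bar>\<xi>\<bar>"
        using that by (intro mult_right_mono) auto
      hence "N \<le> 1 - exp (- 2 * (s * \<bar>\<xi>\<bar>) * freq_gap L m)"
        by (simp add: N_def mult_ac)
      hence "exp (- 2 * (s * freq_gap L m)) * N / 4
          \<le> exp (- 2 * s * freq_gap L m) * (1 - exp (- 2 * (s * \<bar>\<xi>\<bar>) * freq_gap L m)) / 4"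
        by (simp add: mult_ac)
      also have "\<dots> \<le> D"
        unfolding D_def by (rule walk_entropy_change[OF L0 s0 \<xi>])
      finally show ?thesis .
    qed
    have c_eq: "2 * c \<bar>\<xi>\<bar> = 2 * N / K"
      by (simp add: c_def N_def)
    have "2 * c \<bar>\<xi>\<bar> * min (walk_rel_entropy k L s) 1 \<le> D"
    proof (cases "a \<le> s * freq_gap L 1")
      case True
      define E where "E = exp (- 2 * (s * freq_gap L 1))"
      have "walk_rel_entropy k L s \<le> C * E"
        using walk_rel_entropy_le[OF L0 s0, of k] sum_exp_freq_gap_le[OF L a(1) True]
        unfolding C_def E_def by (simp add: mult.assoc)
      hence "2 * N / K * min (walk_rel_entropy k L s) 1 \<le> 2 * N / K * (C * E)"
        using N K(1) by (intro mult_left_mono) auto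
      also have "\<dots> = N * E * (2 * C / K)"
        by simp
      also have "\<dots> \<le> N * E * (1 / 4)"
        using N K by (intro mult_left_mono) (auto simp: E_def field_simps)
      also have "\<dots> \<le> D"
        using D[OF True] by (simp add: E_def mult_ac)
      finally show ?thesis unfolding c_eq .
    next
      case False
      then obtain m where m: "a \<le> s * freq_gap L m" "s * freq_gap L m \<le> 4 * a"
        using exists_resonant_frequency[OF L a(1), of s] a s by auto
      have "2 * N / K * min (walk_rel_entropy k L s) 1 \<le> 2 * N / K * 1"
        using N K(1) by (intro mult_left_mono) auto
      also have "\<dots> \<le> 2 * N / (8 * exp 2) * 1"
        using N K by (intro mult_right_mono divide_left_mono) auto
      also have "\<dots> = exp (- 2) * N / 4"
        by (simp add: exp_minus field_simps)
      also have "\<dots> \<le> exp (- 2 * (s * freq_gap L m)) * N / 4"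
        using m a N by (intro divide_right_mono mult_right_mono) auto
      also have "\<dots> \<le> D" by (rule D[OF m(1)])
      finally show ?thesis unfolding c_eq .
    qed
    thus ?thesis by (simp add: D_def)
  qed
  ultimately show ?thesis by blast
qed

end
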